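(* Let $A=(A_1,\dots,A_n)$ be a contractive $n$-tuple on a finite dimensional Hilbert space $\mathcal V$ with joint minimal isometric dilation $S=(S_1,\dots,S_n)$, let $\mathfrak S$ be the WOT-closed unital algebra generated by the $S_i$, and let $\Phi(X)=\sum_{i=1}^nA_iXA_i^*$ on $\mathcal B(\mathcal V)$. The pure rank of $\mathfrak S$ is computed as $$\operatorname{pure\,rank}(\mathfrak S)=\operatorname{rank}(I-\Phi(I))=\operatorname{rank}\Bigl(I-\sum_{i=1}^nA_iA_i^*\Bigr).$$
   Context: Fix an integer $n\ge2$. $A$ is contractive if $\sum_iA_iA_i^*\le I$. Its minimal joint isometric dilation is an $n$-tuple $S$ of isometries with pairwise orthogonal ranges on a Hilbert space $\mathcal H\supseteq\mathcal V$ with $\mathcal V$ invariant for each $S_i^*$, $S_i^*|_{\mathcal V}=A_i^*$, and $\mathcal H$ equal to the closed span of $\{S_{i_1}\cdots S_{i_k}\mathcal V:k\ge0,\ 1\le i_j\le n\}$; it exists and is unique up to a unitary equivalence fixing $\mathcal V$. The pure rank of $\mathfrak S$ is $\dim\operatorname{Ran}\bigl(I-\sum_{i=1}^nS_iS_i^*\bigr)$ (equivalently the multiplicity of the left regular representation of the free semigroup in the Wold decomposition of $S$). *)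

theory Defs
  imports "HOL-Analysis.Analysis"
begin

section \<open>Complex Hilbert spaces\<close>

class complex_vector = real_vector +
  fixes scaleC :: "complex \<Rightarrow> 'a \<Rightarrow> 'a"  (infixr \<open>*\<^sub>C\<close> 75)
  assumes scaleC_add_right: "a *\<^sub>C (x + y) = a *\<^sub>C x + a *\<^sub>C y"
    and scaleC_add_left: "(a + b) *\<^sub>C x = a *\<^sub>C x + b *\<^sub>C x"
    and scaleC_scaleC: "a *\<^sub>C (b *\<^sub>C x) = (a * b) *\<^sub>C x"
    and scaleC_one: "1 *\<^sub>C x = x"
    and scaleR_scaleC: "r *\<^sub>R x = complex_of_real r *\<^sub>C x"

text \<open>The inner product is linear in its first argument.  Positive definiteness is
  contained in the last axiom, because the right-hand side is a nonnegative real that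
  vanishes only for \<open>x = 0\<close>.\<close>

class complex_inner = complex_vector + real_normed_vector +
  fixes cinner :: "'a \<Rightarrow> 'a \<Rightarrow> complex"
  assumes cinner_commute: "cinner x y = cnj (cinner y x)"
    and cinner_add_left: "cinner (x + y) z = cinner x z + cinner y z"
    and cinner_scaleC_left: "cinner (a *\<^sub>C x) y = a * cinner x y"
    and cinner_self: "cinner x x = complex_of_real ((norm x)\<^sup>2)"

class chilbert_space = complex_inner + complete_space

global_interpretation complex_vector:
  vector_space "scaleC :: complex \<Rightarrow> 'a \<Rightarrow> 'a::complex_vector"
  by unfold_locales
    (simp_all add: scaleC_add_right scaleC_add_left scaleC_scaleC scaleC_one)

abbreviation cspan :: "'a::complex_vector set \<Rightarrow> 'a set"
  where "cspan \<equiv> module.span scaleC"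

abbreviation clinear :: "('a::complex_vector \<Rightarrow> 'b::complex_vector) \<Rightarrow> bool"
  where "clinear \<equiv> Vector_Spaces.linear scaleC scaleC"

definition cfinite_dim :: "'a::complex_vector set \<Rightarrow> bool"
  where "cfinite_dim U \<longleftrightarrow> (\<exists>B. finite B \<and> U \<subseteq> cspan B)"

text \<open>The library's \<open>dim\<close> is 0 on infinite-dimensional subspaces, hence the case distinction.\<close>

definition cdim :: "'a::complex_vector set \<Rightarrow> enat"
  where "cdim U = (if cfinite_dim U then enat (vector_space.dim scaleC U) else \<infinity>)"


section \<open>Operators\<close>

definition bounded_clinear :: "('a::complex_inner \<Rightarrow> 'b::complex_inner) \<Rightarrow> bool"
  where "bounded_clinear T \<longleftrightarrow> clinear T \<and> (\<exists>K. \<forall>x. norm (T x) \<le> K * norm x)"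

definition cadjoint :: "('a::complex_inner \<Rightarrow> 'b::complex_inner) \<Rightarrow> 'b \<Rightarrow> 'a"
  where "cadjoint T = (THE R. \<forall>x y. cinner (T x) y = cinner x (R y))"

definition rank_op :: "('a::complex_vector \<Rightarrow> 'b::complex_vector) \<Rightarrow> enat"
  where "rank_op T = cdim (range T)"

definition positive_op :: "('a::complex_inner \<Rightarrow> 'a) \<Rightarrow> bool"
  where "positive_op T \<longleftrightarrow> (\<forall>x. cinner (T x) x \<in> \<real>\<^sub>\<ge>\<^sub>0)"

definition isometry_op :: "('a::complex_inner \<Rightarrow> 'b::complex_inner) \<Rightarrow> bool"
  where "isometry_op T \<longleftrightarrow> clinear T \<and> (\<forall>x. norm (T x) = norm x)"

text \<open>The weak operator topology on the bounded operators: the coarsest topology making all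
  maps \<open>T \<mapsto> \<langle>T x, y\<rangle>\<close> continuous.  The topology on the function type
  \<open>'a \<times> 'b \<Rightarrow> complex\<close> is that of pointwise convergence.\<close>

definition weak_operator_topology :: "('a::complex_inner \<Rightarrow> 'b::complex_inner) topology"
  where "weak_operator_topology =
    pullback_topology {T. bounded_clinear T} (\<lambda>T (x, y). cinner (T x) y) euclidean"


section \<open>Tuples and dilations\<close>

text \<open>An \<open>n\<close>-tuple is a function on indices of which only the values at \<open>1, \<dots>, n\<close> matter.\<close>

definition cp_map ::
    "nat \<Rightarrow> (nat \<Rightarrow> 'v::complex_inner \<Rightarrow> 'v) \<Rightarrow> ('v \<Rightarrow> 'v) \<Rightarrow> 'v \<Rightarrow> 'v"
  where "cp_map n A X = (\<lambda>v. \<Sum>i=1..n. A i (X (cadjoint (A i) v)))"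

definition contractive_tuple :: "nat \<Rightarrow> (nat \<Rightarrow> 'v::complex_inner \<Rightarrow> 'v) \<Rightarrow> bool"
  where "contractive_tuple n A \<longleftrightarrow>
    (\<forall>i\<in>{1..n}. bounded_clinear (A i)) \<and>
    positive_op (\<lambda>v. v - (\<Sum>i=1..n. A i (cadjoint (A i) v)))"

definition isometric_tuple :: "nat \<Rightarrow> (nat \<Rightarrow> 'h::complex_inner \<Rightarrow> 'h) \<Rightarrow> bool"
  where "isometric_tuple n S \<longleftrightarrow>
    (\<forall>i\<in>{1..n}. isometry_op (S i)) \<and>
    (\<forall>i\<in>{1..n}. \<forall>j\<in>{1..n}. i \<noteq> j \<longrightarrow> (\<forall>x y. cinner (S i x) (S j y) = 0))"

definition word_op :: "(nat \<Rightarrow> 'h \<Rightarrow> 'h) \<Rightarrow> nat list \<Rightarrow> 'h \<Rightarrow> 'h"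
  where "word_op S w = foldr (\<lambda>i T. S i \<circ> T) w id"

text \<open>The inclusion of \<open>\<V>\<close> into the dilation space is a linear isometry \<open>J\<close>, so
  \<open>range J\<close> is the copy of \<open>\<V>\<close> inside the larger space.\<close>

definition minimal_isometric_dilation ::
    "nat \<Rightarrow> (nat \<Rightarrow> 'v::chilbert_space \<Rightarrow> 'v) \<Rightarrow> ('v \<Rightarrow> 'h::chilbert_space)
      \<Rightarrow> (nat \<Rightarrow> 'h \<Rightarrow> 'h) \<Rightarrow> bool"
  where "minimal_isometric_dilation n A J S \<longleftrightarrow>
    isometric_tuple n S \<and>
    isometry_op J \<and>
    (\<forall>i\<in>{1..n}. cadjoint (S i) ` range J \<subseteq> range J) \<and>
    (\<forall>i\<in>{1..n}. \<forall>v. cadjoint (S i) (J v) = J (cadjoint (A i) v)) \<and>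
    closure (cspan (\<Union>w\<in>lists {1..n}. word_op S w ` range J)) = UNIV"


section \<open>Free semigroup algebras\<close>

definition wot_closed_unital_algebra :: "('h::complex_inner \<Rightarrow> 'h) set \<Rightarrow> bool"
  where "wot_closed_unital_algebra M \<longleftrightarrow>
    M \<subseteq> {T. bounded_clinear T} \<and>
    id \<in> M \<and>
    (\<forall>T\<in>M. \<forall>R\<in>M. (\<lambda>x. T x + R x) \<in> M) \<and>
    (\<forall>c. \<forall>T\<in>M. (\<lambda>x. c *\<^sub>C T x) \<in> M) \<and>
    (\<forall>T\<in>M. \<forall>R\<in>M. T \<circ> R \<in> M) \<and>
    closedin weak_operator_topology M"

text \<open>The pure rank is defined through the generating isometries, so a free semigroup algebra
  is recorded together with its generators.\<close>

record 'h fs_algebra =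
  num_gens :: nat
  gen :: "nat \<Rightarrow> 'h \<Rightarrow> 'h"
  elements :: "('h \<Rightarrow> 'h) set"

definition free_semigroup_algebra ::
    "nat \<Rightarrow> (nat \<Rightarrow> 'h::complex_inner \<Rightarrow> 'h) \<Rightarrow> 'h fs_algebra"
  where "free_semigroup_algebra n S =
    \<lparr>num_gens = n, gen = S,
     elements = \<Inter>{M. wot_closed_unital_algebra M \<and> S ` {1..n} \<subseteq> M}\<rparr>"

definition pure_rank :: "'h::complex_inner fs_algebra \<Rightarrow> enat"
  where "pure_rank \<SS> =
    rank_op (\<lambda>x. x - (\<Sum>i=1..num_gens \<SS>. gen \<SS> i (cadjoint (gen \<SS> i) x)))"

end

theory Submission
  imports Defs
begin

text \<open>Write \<open>P = I - \<Sum> S\<^sub>i S\<^sub>i*\<close>, a projection, and \<open>D = I - \<Sum> A\<^sub>i A\<^sub>i*\<close>.  The intertwining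
  \<open>S\<^sub>i* J = J A\<^sub>i*\<close> gives \<open>J* P J = D\<close>.  As \<open>P S\<^sub>i = 0\<close>, a vector in the range of \<open>P\<close> orthogonal to
  \<open>P J \<V>\<close> is orthogonal to every \<open>S\<^sub>w J \<V>\<close>, hence zero by minimality; since \<open>P J \<V>\<close> is
  finite-dimensional, it is all of the range of \<open>P\<close>.  Finally \<open>J*\<close> maps \<open>P J \<V>\<close> onto the
  range of \<open>D\<close>, and it is injective there because \<open>\<langle>D v, v\<rangle> = \<parallel>P J v\<parallel>\<^sup>2\<close>.\<close>

section \<open>Inner products\<close>

lemma cinner_scaleC_right: "cinner x (a *\<^sub>C y) = cnj a * cinner x y"
  by (metis cinner_commute cinner_scaleC_left complex_cnj_mult)

lemma cinner_add_right: "cinner x (y + z) = cinner x y + cinner x z"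
  by (metis cinner_commute cinner_add_left complex_cnj_add)

lemma cinner_zero_left [simp]: "cinner 0 x = 0"
  using cinner_add_left[of 0 0 x] by simp

lemma cinner_zero_right [simp]: "cinner x 0 = 0"
  using cinner_add_right[of x 0 0] by simp

lemma cinner_minus_left: "cinner (- x) y = - cinner x y"
  using cinner_add_left[of x "- x" y] by (simp add: eq_neg_iff_add_eq_0 add.commute)

lemma cinner_minus_right: "cinner x (- y) = - cinner x y"
  using cinner_add_right[of x y "- y"] by (simp add: eq_neg_iff_add_eq_0 add.commute)

lemma cinner_diff_left: "cinner (x - y) z = cinner x z - cinner y z"
  by (simp only: diff_conv_add_uminus cinner_add_left cinner_minus_left)

lemma cinner_diff_right: "cinner x (y - z) = cinner x y - cinner x z"
  by (simp only: diff_conv_add_uminus cinner_add_right cinner_minus_right)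

lemma cinner_sum_right: "cinner y (\<Sum>i\<in>I. f i) = (\<Sum>i\<in>I. cinner y (f i))"
  by (induction I rule: infinite_finite_induct) (auto simp: cinner_add_right)

lemma cinner_self_eq_0_iff [simp]: "cinner x x = 0 \<longleftrightarrow> x = 0"
  by (simp add: cinner_self)

lemma cinner_eqI:
  assumes "\<And>z. cinner z x = cinner z y"
  shows "x = y"
proof -
  have "cinner (x - y) (x - y) = 0"
    using assms by (simp add: cinner_diff_right)
  then show ?thesis by simp
qed

text \<open>This expansion links the given norm to the inner product; the parallelogram law,
  Pythagoras and polarisation below all come from it.\<close>

lemma norm_add_square: "(norm (x + y))\<^sup>2 = (norm x)\<^sup>2 + (norm y)\<^sup>2 + 2 * Re (cinner x y)"
proof -
  have "complex_of_real ((norm (x + y))\<^sup>2) = cinner (x + y) (x + y)"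
    by (simp add: cinner_self)
  also have "\<dots> = of_real ((norm x)\<^sup>2) + of_real ((norm y)\<^sup>2) + (cinner x y + cnj (cinner x y))"
    by (simp only: cinner_add_left cinner_add_right cinner_self[symmetric] cinner_commute[symmetric] add_ac)
  also have "\<dots> = of_real ((norm x)\<^sup>2 + (norm y)\<^sup>2 + 2 * Re (cinner x y))"
    by (simp add: complex_add_cnj)
  finally show ?thesis
    using of_real_eq_iff by blast
qed

lemma norm_scaleC: "norm (a *\<^sub>C x) = cmod a * norm (x::'a::complex_inner)"
proof -
  have "complex_of_real ((norm (a *\<^sub>C x))\<^sup>2) = (a * cnj a) * of_real ((norm x)\<^sup>2)"
    by (simp only: cinner_scaleC_left cinner_scaleC_right cinner_self[symmetric] mult_ac)
  also have "\<dots> = of_real ((cmod a * norm x)\<^sup>2)"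
    by (simp add: complex_norm_square[symmetric] power_mult_distrib)
  finally have "(norm (a *\<^sub>C x))\<^sup>2 = (cmod a * norm x)\<^sup>2"
    using of_real_eq_iff by blast
  then show ?thesis by (simp add: power2_eq_iff_nonneg)
qed

lemma parallelogram:
  fixes x y :: "'a::complex_inner"
  shows "(norm (x + y))\<^sup>2 + (norm (x - y))\<^sup>2 = 2 * (norm x)\<^sup>2 + 2 * (norm y)\<^sup>2"
  using norm_add_square[of x y] norm_add_square[of x "- y"] by (simp add: cinner_minus_right)

text \<open>Squaring the triangle inequality, an axiom of the normed space, bounds the real part.
  Multiplying \<open>x\<close> by a phase \<open>c\<close> of modulus 1 makes the inner product real
  and nonnegative.\<close>

lemma cinner_cauchy_schwarz: "cmod (cinner x y) \<le> norm x * norm y"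
proof (cases "cinner x y = 0")
  case False
  have Re_le: "Re (cinner a b) \<le> norm a * norm b" for a b :: 'a
  proof -
    have "(norm (a + b))\<^sup>2 \<le> (norm a + norm b)\<^sup>2"
      by (simp add: norm_triangle_ineq power_mono)
    then show ?thesis by (simp add: norm_add_square power2_sum)
  qed
  define c where "c = cnj (sgn (cinner x y))"
  have "cmod c = 1" using False by (simp add: c_def norm_sgn)
  moreover have "c * cinner x y = of_real (cmod (cinner x y))"
  proof -
    have "c * cinner x y = cinner x y * cnj (cinner x y) / of_real (cmod (cinner x y))"
      by (simp add: c_def sgn_eq)
    also have "\<dots> = of_real (cmod (cinner x y))"
      using False by (simp add: complex_norm_square[symmetric] power2_eq_square)
    finally show ?thesis .
  qed
  ultimately show ?thesis
    using Re_le[of "c *\<^sub>C x" y] by (simp add: cinner_scaleC_left norm_scaleC)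
qed simp

text \<open>By Pythagoras every element of the span is at distance at least \<open>norm z\<close>
  from \<open>z\<close>, so only \<open>z = 0\<close> can be approximated.\<close>

lemma closure_cspan_orthogonal:
  assumes "z \<in> closure (cspan X)" and "\<And>x. x \<in> X \<Longrightarrow> cinner x z = 0"
  shows "z = 0"
proof (rule ccontr)
  assume "z \<noteq> 0"
  then obtain s where s: "s \<in> cspan X" "dist s z < norm z"
    using assms(1) closure_approachable by (metis zero_less_norm_iff)
  have "cinner s z = 0"
    using s(1)
    by (induction rule: complex_vector.span_induct_alt)
      (auto simp: cinner_add_left cinner_scaleC_left assms(2))
  then have "(norm (s - z))\<^sup>2 = (norm s)\<^sup>2 + (norm z)\<^sup>2"
    using norm_add_square[of s "- z"] by (simp add: cinner_minus_right)
  then have "(norm z)\<^sup>2 \<le> (norm (s - z))\<^sup>2" by simp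
  then show False
    using s(2) by (simp add: dist_norm power2_le_iff_abs_le)
qed

text \<open>One Gram-Schmidt step per element of \<open>B\<close>. Keeping \<open>x\<close>
  arbitrary lets the induction hypothesis apply both to \<open>x\<close> and to the new vector
  \<open>b\<close>.\<close>

lemma orthogonal_decomposition_cspan:
  assumes "finite B"
  shows "\<exists>u\<in>cspan B. \<forall>b\<in>B. cinner b (x - u) = 0"
  using assms
proof (induction B arbitrary: x)
  case empty
  then show ?case by auto
next
  case (insert b B)
  obtain u where u: "u \<in> cspan B" "\<forall>c\<in>B. cinner c (x - u) = 0" using insert by blast
  obtain p where p: "p \<in> cspan B" "\<forall>c\<in>B. cinner c (b - p) = 0" using insert by blast
  have ann: "cinner s y = 0" if "s \<in> cspan B" "\<forall>c\<in>B. cinner c y = 0" for s y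
    using that
    by (induction rule: complex_vector.span_induct_alt)
      (auto simp: cinner_add_left cinner_scaleC_left)
  define q where "q = b - p"
  \<comment> \<open>The conjugate compensates for antilinearity in the second argument. If
    \<open>q = 0\<close>, division by zero gives \<open>t = 0\<close> and orthogonality to
    \<open>q\<close> is trivial.\<close>
  define t where "t = cnj (cinner q (x - u) / cinner q q)"
  let ?u = "u + t *\<^sub>C q"
  have sub: "cspan B \<subseteq> cspan (insert b B)"
    by (rule complex_vector.span_mono) auto
  then have "?u \<in> cspan (insert b B)"
    unfolding q_def using u(1) p(1)
    by (intro complex_vector.span_add complex_vector.span_scale complex_vector.span_diff)
      (auto intro: complex_vector.span_base)
  moreover have B: "\<forall>c\<in>B. cinner c (x - ?u) = 0"
    using u(2) p(2) unfolding q_def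
    by (auto simp: cinner_diff_right cinner_add_right cinner_scaleC_right)
  moreover have "cinner b (x - ?u) = 0"
  proof -
    have "cinner q (x - ?u) = 0"
      by (cases "q = 0")
        (auto simp: t_def diff_diff_add[symmetric] cinner_diff_right[of _ "x - u"] cinner_scaleC_right)
    moreover have "cinner p (x - ?u) = 0"
      using ann[OF p(1) B] .
    ultimately show ?thesis
      unfolding q_def by (simp add: cinner_diff_left)
  qed
  ultimately show ?case by blast
qed


section \<open>Linear maps\<close>

lemma clinear_add: "clinear T \<Longrightarrow> T (x + y) = T x + T y"
  and clinear_scaleC: "clinear T \<Longrightarrow> T (c *\<^sub>C x) = c *\<^sub>C T x"
  by (auto simp: Vector_Spaces.linear_def dest: module_hom.add module_hom.scale)

lemma clinearI:
  assumes "\<And>x y. T (x + y) = T x + T y" and "\<And>c x. T (c *\<^sub>C x) = c *\<^sub>C T x"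
  shows "clinear T"
  using assms
  by (intro Vector_Spaces.linear.intro module_hom.intro module_hom_axioms.intro
      complex_vector.vector_space_axioms complex_vector.module_axioms)

text \<open>A basis \<open>C\<close> extracted from \<open>B\<close> is mapped to a basis of the
  image. Finiteness of \<open>B\<close> puts both sides in the finite case of
  \<open>cdim\<close>.\<close>

lemma cdim_injective_image:
  assumes f: "clinear f" and inj: "inj_on f (cspan B)" and B: "finite B"
  shows "cdim (f ` cspan B) = cdim (cspan B)"
proof -
  interpret f: Vector_Spaces.linear scaleC scaleC f by (fact f)
  obtain C where C: "C \<subseteq> B" "complex_vector.independent C" "B \<subseteq> cspan C"
    using complex_vector.maximal_independent_subset by blast
  have span: "cspan C = cspan B"
    using C by (metis complex_vector.span_eq complex_vector.span_superset subset_trans)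
  have ind: "complex_vector.independent (f ` C)"
    using f.independent_injective_image C(2) inj span by simp
  have fin: "finite C" using B C(1) finite_subset by blast
  have img: "f ` cspan B = cspan (f ` C)"
    by (simp add: f.span_image span)
  have "card (f ` C) = card C"
    using inj C(1) complex_vector.span_superset[of B] by (intro card_image) (meson inj_on_subset subset_trans)
  then have "complex_vector.dim (f ` cspan B) = complex_vector.dim (cspan B)"
    using ind C(2) unfolding img
    by (simp add: complex_vector.dim_eq_card_independent flip: span)
  moreover have "cfinite_dim (f ` cspan B)" "cfinite_dim (cspan B)"
    unfolding cfinite_dim_def using img B fin by (metis finite_imageI subset_refl)+
  ultimately show ?thesis by (simp add: cdim_def)
qed


section \<open>Adjoints\<close>

text \<open>The representing vector minimises \<open>\<parallel>x\<parallel>\<^sup>2 - 2 Re f(x)\<close>; by the parallelogram law every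
  minimising sequence is Cauchy.\<close>

lemma riesz_representation:
  fixes f :: "'a::chilbert_space \<Rightarrow> complex"
  assumes add: "\<And>x y. f (x + y) = f x + f y" and scale: "\<And>c x. f (c *\<^sub>C x) = c * f x"
    and bound: "\<And>x. cmod (f x) \<le> K * norm x"
  shows "\<exists>y. \<forall>x. f x = cinner x y"
proof -
  define \<phi> where "\<phi> x = (norm x)\<^sup>2 - 2 * Re (f x)" for x
  have scaleR: "f (r *\<^sub>R x) = of_real r * f x" for r x
    by (simp add: scaleR_scaleC scale)
  have blin: "bounded_linear f"
    by (rule bounded_linear_intro[where K = K])
      (auto simp: add scaleR scaleR_conv_of_real bound mult.commute)
  \<comment> \<open>Completing the square; the bound makes the infimum \<open>m\<close>
    meaningful.\<close>
  have lower: "- K\<^sup>2 \<le> \<phi> x" for x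
  proof -
    have "Re (f x) \<le> K * norm x"
      using bound[of x] complex_Re_le_cmod[of "f x"] by linarith
    moreover have "0 \<le> (norm x - K)\<^sup>2" by simp
    ultimately show ?thesis
      by (simp add: \<phi>_def power2_diff algebra_simps)
  qed
  define m where "m = Inf (range \<phi>)"
  have bdd: "bdd_below (range \<phi>)"
    using lower by (meson bdd_belowI2)
  have m_le: "m \<le> \<phi> x" for x
    unfolding m_def by (rule cInf_lower[OF _ bdd]) auto
  have "\<exists>x. \<phi> x < m + e" if "e > 0" for e
    using cInf_lessD[of "range \<phi>" "m + e"] that by (auto simp: m_def)
  then have "\<exists>x. \<phi> x < m + 1 / Suc k" for k :: nat by simp
  then obtain X where X: "\<phi> (X k) < m + 1 / Suc k" for k :: nat
    by metis
  have gap: "(norm (x - y))\<^sup>2 \<le> 2 * (\<phi> x - m) + 2 * (\<phi> y - m)" for x y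
  proof -
    \<comment> \<open>At the midpoint \<open>\<phi>\<close> is still at least \<open>m\<close>,
      which limits how far apart two near-minimisers can be.\<close>
    let ?z = "(1/2) *\<^sub>R (x + y)"
    have "(norm ?z)\<^sup>2 = (norm (x + y))\<^sup>2 / 4" by (simp add: power_divide)
    moreover have "Re (f ?z) = (Re (f x) + Re (f y)) / 2" unfolding scaleR by (simp add: add)
    ultimately show ?thesis
      using m_le[of ?z] parallelogram[of x y] unfolding \<phi>_def by argo
  qed
  have "Cauchy X"
  proof (rule metric_CauchyI)
    fix e :: real assume "e > 0"
    then have "e\<^sup>2 / 4 > 0" by simp
    then obtain M where M: "1 / Suc M < e\<^sup>2 / 4"
      using reals_Archimedean by (metis inverse_eq_divide)
    have close: "\<phi> (X k) - m < e\<^sup>2 / 4" if "k \<ge> M" for k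
    proof -
      have "1 / real (Suc k) \<le> 1 / real (Suc M)" using that by (simp add: frac_le)
      then show ?thesis using X[of k] M by linarith
    qed
    have "dist (X j) (X k) < e" if "j \<ge> M" "k \<ge> M" for j k
    proof -
      have "(norm (X j - X k))\<^sup>2 < e\<^sup>2"
        using gap[of "X j" "X k"] close[OF that(1)] close[OF that(2)] by argo
      then show ?thesis
        using \<open>e > 0\<close> by (simp add: dist_norm power2_less_imp_less)
    qed
    then show "\<exists>M. \<forall>j\<ge>M. \<forall>k\<ge>M. dist (X j) (X k) < e" by blast
  qed
  then obtain y where y: "X \<longlonglongrightarrow> y"
    using Cauchy_convergent convergent_def by blast
  have "(\<lambda>k. \<phi> (X k)) \<longlonglongrightarrow> \<phi> y"
    unfolding \<phi>_def by (intro tendsto_intros y bounded_linear.tendsto[OF blin])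
  moreover have "(\<lambda>k. m + 1 / real (Suc k)) \<longlonglongrightarrow> m + 0"
    by (intro tendsto_intros LIMSEQ_Suc lim_1_over_n)
  ultimately have "\<phi> y \<le> m + 0"
    using X by (intro LIMSEQ_le) (auto intro: less_imp_le)
  then have min: "\<phi> y \<le> \<phi> x" for x
    using m_le[of x] by simp
  \<comment> \<open>The first variation of \<open>\<phi>\<close> at its minimiser \<open>y\<close>
    vanishes in every direction \<open>h\<close>.\<close>
  have Re_eq: "Re (f h) = Re (cinner h y)" for h
  proof (rule ccontr)
    assume ne: "Re (f h) \<noteq> Re (cinner h y)"
    define d where "d = Re (f h) - Re (cinner h y)"
    \<comment> \<open>The added 1 keeps \<open>N\<close> positive even for \<open>h = 0\<close>. The
      step length \<open>d / N\<close> would then lower \<open>\<phi>\<close> by at least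
      \<open>d\<^sup>2 / N\<close>.\<close>
    define N where "N = (norm h)\<^sup>2 + 1"
    have N: "N > 0" by (simp add: N_def add_nonneg_pos)
    have "\<phi> (y + t *\<^sub>R h) = \<phi> y + t\<^sup>2 * (norm h)\<^sup>2 - 2 * t * d" for t
    proof -
      have "Re (cinner y (t *\<^sub>R h)) = t * Re (cinner h y)"
        using cinner_commute[of y h] by (simp add: scaleR_scaleC cinner_scaleC_right)
      then show ?thesis
        by (simp add: \<phi>_def norm_add_square add scaleR power_mult_distrib d_def algebra_simps)
    qed
    then have "0 \<le> (d / N)\<^sup>2 * (norm h)\<^sup>2 - 2 * (d / N) * d"
      using min[of "y + (d / N) *\<^sub>R h"] by (smt (verit))
    also have "\<dots> \<le> (d / N)\<^sup>2 * N - 2 * (d / N) * d"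
      by (simp add: N_def mult_left_mono)
    also have "\<dots> = - (d\<^sup>2 / N)"
      using N by (simp add: power2_eq_square field_simps)
    finally have "d\<^sup>2 / N \<le> 0" by simp
    then have "d = 0" using N by (simp add: divide_le_0_iff)
    then show False using ne by (simp add: d_def)
  qed
  \<comment> \<open>Multiplying \<open>x\<close> by the imaginary unit turns imaginary parts into
    real parts, up to sign.\<close>
  have "f x = cinner x y" for x
    using Re_eq[of x] Re_eq[of "\<i> *\<^sub>C x"]
    by (simp add: scale cinner_scaleC_left complex_eq_iff)
  then show ?thesis by blast
qed

text \<open>Riesz representation gives existence and \<open>cinner_eqI\<close> gives uniqueness, so
  the definite description in \<open>cadjoint\<close> denotes the adjoint.\<close>

lemma cinner_cadjoint_right:
  fixes T :: "'a::chilbert_space \<Rightarrow> 'b::complex_inner"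
  assumes "bounded_clinear T"
  shows "cinner x (cadjoint T y) = cinner (T x) y"
proof -
  obtain K where T: "clinear T" and K: "\<And>x. norm (T x) \<le> K * norm x"
    using assms unfolding bounded_clinear_def by blast
  have "\<exists>z. \<forall>x. cinner (T x) y = cinner x z" for y
  proof (rule riesz_representation[where K = "K * norm y"])
    show "cmod (cinner (T x) y) \<le> K * norm y * norm x" for x
      using order_trans[OF cinner_cauchy_schwarz mult_right_mono[OF K norm_ge_zero]]
      by (simp add: ac_simps)
  qed (simp_all add: clinear_add[OF T] clinear_scaleC[OF T] cinner_add_left cinner_scaleC_left)
  then obtain R where R: "\<forall>x y. cinner (T x) y = cinner x (R y)" by metis
  have "cadjoint T = R"
    unfolding cadjoint_def
  proof (rule the_equality)
    fix R' assume "\<forall>x y. cinner (T x) y = cinner x (R' y)"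
    with R show "R' = R" by (intro ext cinner_eqI) simp
  qed (fact R)
  with R show ?thesis by simp
qed

lemma cinner_cadjoint_left:
  fixes T :: "'a::chilbert_space \<Rightarrow> 'b::complex_inner"
  assumes "bounded_clinear T"
  shows "cinner (cadjoint T y) x = cinner y (T x)"
  by (metis cinner_commute cinner_cadjoint_right[OF assms])

lemma clinear_cadjoint:
  fixes T :: "'a::chilbert_space \<Rightarrow> 'b::complex_inner"
  assumes "bounded_clinear T"
  shows "clinear (cadjoint T)"
  by (intro clinearI cinner_eqI)
    (simp_all add: cinner_cadjoint_right[OF assms] cinner_add_right cinner_scaleC_right)

lemma isometry_op_bounded_clinear: "isometry_op T \<Longrightarrow> bounded_clinear T"
  unfolding isometry_op_def bounded_clinear_def by (metis mult_1 order_refl)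

text \<open>Polarisation: norms of sums determine the real part, and the same identity at
  \<open>\<i>\<close> times \<open>x\<close> determines the imaginary part.\<close>

lemma isometry_op_cinner:
  assumes "isometry_op T"
  shows "cinner (T x) (T y) = cinner x y"
proof -
  have T: "clinear T" and norm: "\<And>x. norm (T x) = norm x"
    using assms unfolding isometry_op_def by auto
  have Re_eq: "Re (cinner (T x) (T y)) = Re (cinner x y)" for x y
    using norm_add_square[of "T x" "T y"] norm_add_square[of x y]
    by (simp add: norm flip: clinear_add[OF T])
  show ?thesis
    using Re_eq[of x y] Re_eq[of "\<i> *\<^sub>C x" y]
    by (simp add: clinear_scaleC[OF T] cinner_scaleC_left complex_eq_iff)
qed


section \<open>The defect projection\<close>

text \<open>These are the Cuntz-Toeplitz relations: isometry gives the diagonal case, orthogonality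
  of the ranges the other.\<close>

lemma isometric_tuple_cadjoint:
  fixes S :: "nat \<Rightarrow> 'h::chilbert_space \<Rightarrow> 'h"
  assumes "isometric_tuple n S" and "i \<in> {1..n}" and "j \<in> {1..n}"
  shows "cadjoint (S j) (S i x) = (if i = j then x else 0)"
proof (rule cinner_eqI)
  have iso: "isometry_op (S j)"
    and orth: "i \<noteq> j \<Longrightarrow> cinner (S j z) (S i x) = 0" for z
    using assms unfolding isometric_tuple_def by auto
  show "cinner z (cadjoint (S j) (S i x)) = cinner z (if i = j then x else 0)" for z
    using orth isometry_op_cinner[OF iso]
    by (auto simp: cinner_cadjoint_right[OF isometry_op_bounded_clinear[OF iso]])
qed

text \<open>The range is the wandering subspace of the Wold decomposition, the orthogonal complement
  of the ranges of the \<open>S i\<close>.\<close>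

definition wandering_projection ::
    "nat \<Rightarrow> (nat \<Rightarrow> 'h::complex_inner \<Rightarrow> 'h) \<Rightarrow> 'h \<Rightarrow> 'h"
  where "wandering_projection n S x = x - (\<Sum>i=1..n. S i (cadjoint (S i) x))"

context
  fixes n :: nat and S :: "nat \<Rightarrow> 'h::chilbert_space \<Rightarrow> 'h"
  assumes S: "isometric_tuple n S"
begin

lemma bounded_clinear_gen: "i \<in> {1..n} \<Longrightarrow> bounded_clinear (S i)"
  using S unfolding isometric_tuple_def by (simp add: isometry_op_bounded_clinear)

lemma clinear_gen: "i \<in> {1..n} \<Longrightarrow> clinear (S i)"
  using bounded_clinear_gen unfolding bounded_clinear_def by blast

lemma clinear_wandering_projection: "clinear (wandering_projection n S)"
proof (rule clinearI)
  show "wandering_projection n S (x + y) = wandering_projection n S x + wandering_projection n S y"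
    for x y
    by (simp add: wandering_projection_def clinear_add clinear_gen clinear_cadjoint
        bounded_clinear_gen sum.distrib)
  show "wandering_projection n S (c *\<^sub>C x) = c *\<^sub>C wandering_projection n S x" for c x
    by (simp add: wandering_projection_def clinear_scaleC clinear_gen clinear_cadjoint
        bounded_clinear_gen complex_vector.scale_sum_right complex_vector.scale_right_diff_distrib)
qed

lemma wandering_projection_gen:
  assumes "i \<in> {1..n}"
  shows "wandering_projection n S (S i x) = 0"
proof -
  have "S j (cadjoint (S j) (S i x)) = (if i = j then S i x else 0)" if "j \<in> {1..n}" for j
    using clinear_add[OF clinear_gen[OF that], of 0 0]
    by (simp add: isometric_tuple_cadjoint[OF S assms that])
  then show ?thesis
    using assms by (simp add: wandering_projection_def)
qed

text \<open>This form is Hermitian at sight, which yields self-adjointness; it also exposes the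
  adjoints \<open>cadjoint (S i)\<close>, to which the dilation property applies.\<close>

lemma cinner_wandering_projection:
  "cinner x (wandering_projection n S y)
    = cinner x y - (\<Sum>i=1..n. cinner (cadjoint (S i) x) (cadjoint (S i) y))"
  by (simp add: wandering_projection_def cinner_diff_right cinner_sum_right
      cinner_cadjoint_left bounded_clinear_gen)

lemma wandering_projection_self_adjoint:
  "cinner (wandering_projection n S x) y = cinner x (wandering_projection n S y)"
proof -
  have "cinner (wandering_projection n S x) y = cnj (cinner y (wandering_projection n S x))"
    by (rule cinner_commute)
  also have "\<dots> = cinner x (wandering_projection n S y)"
    by (simp add: cinner_wandering_projection flip: cinner_commute)
  finally show ?thesis .
qed

text \<open>Self-adjointness and the vanishing on each range of \<open>S i\<close> make the range of
  the projection orthogonal to the subtracted sum.\<close>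

lemma wandering_projection_idem:
  "wandering_projection n S (wandering_projection n S x) = wandering_projection n S x"
proof (rule cinner_eqI)
  have orth: "cinner (wandering_projection n S z) (S i y) = 0" if "i \<in> {1..n}" for i z y
    by (simp only: wandering_projection_self_adjoint wandering_projection_gen[OF that] cinner_zero_right)
  have "cinner (wandering_projection n S z) (wandering_projection n S x)
      = cinner (wandering_projection n S z) x" for z
    by (simp add: wandering_projection_def[of n S x] cinner_diff_right cinner_sum_right orth)
  then show "cinner z (wandering_projection n S (wandering_projection n S x))
      = cinner z (wandering_projection n S x)" for z
    by (simp add: wandering_projection_self_adjoint)
qed

text \<open>Minimality by itself makes the image of \<open>cspan B\<close> dense in the range.
  Finiteness of \<open>B\<close> supplies a genuine orthogonal decomposition and so removes the
  closure.\<close>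

lemma range_wandering_projection:
  assumes dense: "closure (cspan (\<Union>w\<in>lists {1..n}. word_op S w ` cspan B)) = UNIV"
    and B: "finite B"
  shows "range (wandering_projection n S) = wandering_projection n S ` cspan B"
proof
  let ?P = "wandering_projection n S"
  interpret P: Vector_Spaces.linear scaleC scaleC ?P
    by (fact clinear_wandering_projection)
  show "range ?P \<subseteq> ?P ` cspan B"
  proof
    fix z assume "z \<in> range ?P"
    then have z: "?P z = z" using wandering_projection_idem by auto
    obtain u where u: "u \<in> cspan (?P ` B)" and orth: "\<forall>b\<in>?P ` B. cinner b (z - u) = 0"
      using orthogonal_decomposition_cspan[of "?P ` B" z] B by blast
    have "?P u = u"
      using u wandering_projection_idem by (auto simp: P.span_image)
    \<comment> \<open>Since the residual is fixed by \<open>?P\<close>, its inner product with any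
      vector equals that with the image of the vector under \<open>?P\<close>.\<close>
    then have w_fix: "?P (z - u) = z - u" by (simp add: P.diff z)
    have B_orth: "cinner x (z - u) = 0" if "x \<in> cspan B" for x
      using that
    proof (induction rule: complex_vector.span_induct_alt)
      case (step c b y)
      have "cinner b (z - u) = 0"
        using orth step wandering_projection_self_adjoint[of b "z - u"] w_fix by simp
      with step show ?case by (simp add: cinner_add_left cinner_scaleC_left)
    qed simp
    have "z - u = 0"
    proof (rule closure_cspan_orthogonal)
      show "z - u \<in> closure (cspan (\<Union>w\<in>lists {1..n}. word_op S w ` cspan B))"
        by (simp only: dense UNIV_I)
    next
      fix x assume "x \<in> (\<Union>w\<in>lists {1..n}. word_op S w ` cspan B)"
      then obtain w b where w: "w \<in> lists {1..n}" and b: "b \<in> cspan B" and x: "x = word_op S w b"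
        by blast
      \<comment> \<open>The empty word leaves a vector of \<open>cspan B\<close>; any other word
        ends up in the range of its first generator, where \<open>?P\<close> vanishes.\<close>
      show "cinner x (z - u) = 0"
      proof (cases w)
        case Nil
        then show ?thesis using x B_orth[OF b] by (simp add: word_op_def)
      next
        case (Cons i w')
        then have "x = S i (word_op S w' b)" "i \<in> {1..n}"
          using x w by (simp_all add: word_op_def)
        then have "?P x = 0" using wandering_projection_gen by simp
        then show ?thesis
          using wandering_projection_self_adjoint[of x "z - u"] w_fix by simp
      qed
    qed
    then show "z \<in> ?P ` cspan B" using u by (simp add: P.span_image)
  qed
qed auto

end

section \<open>Comparison of the wandering and defect ranks through the adjoint of
  \<open>J\<close>\<close>

theorem lemma6p3:
  fixes n :: nat
    and A :: "nat \<Rightarrow> 'v::chilbert_space \<Rightarrow> 'v"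
    and J :: "'v \<Rightarrow> 'h::chilbert_space"
    and S :: "nat \<Rightarrow> 'h \<Rightarrow> 'h"
    and \<SS> :: "'h fs_algebra"
  assumes "n \<ge> 2"
    and "cfinite_dim (UNIV :: 'v set)"
    and "contractive_tuple n A"
    and "minimal_isometric_dilation n A J S"
    and "\<SS> = free_semigroup_algebra n S"
  shows "pure_rank \<SS> = rank_op (\<lambda>v. v - cp_map n A id v)
    \<and> rank_op (\<lambda>v. v - cp_map n A id v)
        = rank_op (\<lambda>v. v - (\<Sum>i=1..n. A i (cadjoint (A i) v)))"
proof -
  let ?P = "wandering_projection n S"
  let ?D = "\<lambda>v. v - (\<Sum>i=1..n. A i (cadjoint (A i) v))"
  have S: "isometric_tuple n S" and J: "isometry_op J"
    and SJ: "\<And>i v. i \<in> {1..n} \<Longrightarrow> cadjoint (S i) (J v) = J (cadjoint (A i) v)"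
    and dense: "closure (cspan (\<Union>w\<in>lists {1..n}. word_op S w ` range J)) = UNIV"
    using assms(4) unfolding minimal_isometric_dilation_def by auto
  have A: "bounded_clinear (A i)" if "i \<in> {1..n}" for i
    using assms(3) that unfolding contractive_tuple_def by blast
  have Jb: "bounded_clinear J" using J by (rule isometry_op_bounded_clinear)
  interpret J: Vector_Spaces.linear scaleC scaleC J
    using J unfolding isometry_op_def by blast
  interpret P: Vector_Spaces.linear scaleC scaleC ?P
    by (rule clinear_wandering_projection[OF S])
  obtain B :: "'v set" where B: "finite B" "cspan B = UNIV"
    using assms(2) unfolding cfinite_dim_def by auto
  have rJ: "range J = cspan (J ` B)" by (simp add: J.span_image B)
  have rP: "range ?P = ?P ` range J"
    using range_wandering_projection[OF S dense[unfolded rJ]] B(1) by (simp add: rJ)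
  \<comment> \<open>Written as the span of a finite set, the range fits
    \<open>cdim_injective_image\<close>.\<close>
  have rP_span: "range ?P = cspan (?P ` J ` B)"
    by (simp add: rP rJ P.span_image)
  \<comment> \<open>Intertwining replaces each \<open>cadjoint (S i)\<close> after \<open>J\<close>
    by \<open>J\<close> after \<open>cadjoint (A i)\<close>, and the isometry \<open>J\<close> then
    drops out of the inner products.\<close>
  have D: "cadjoint J (?P (J v)) = ?D v" for v
  proof (rule cinner_eqI)
    fix z
    have "cinner z (cadjoint J (?P (J v)))
        = cinner z v - (\<Sum>i=1..n. cinner (cadjoint (A i) z) (cadjoint (A i) v))"
      by (simp add: cinner_cadjoint_right[OF Jb] cinner_wandering_projection[OF S] SJ
          isometry_op_cinner[OF J])
    also have "\<dots> = cinner z (?D v)"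
      by (simp add: cinner_diff_right cinner_sum_right cinner_cadjoint_left A)
    finally show "cinner z (cadjoint J (?P (J v))) = cinner z (?D v)" .
  qed
  have rD: "range ?D = cadjoint J ` range ?P"
    unfolding rP image_image D ..
  interpret J': Vector_Spaces.linear scaleC scaleC "cadjoint J"
    by (rule clinear_cadjoint[OF Jb])
  have "inj_on (cadjoint J) (range ?P)"
    unfolding rP_span
  proof (subst J'.inj_on_iff_eq_0)
    show "\<forall>x\<in>cspan (?P ` J ` B). cadjoint J x = 0 \<longrightarrow> x = 0"
    proof (intro ballI impI)
      fix x assume "x \<in> cspan (?P ` J ` B)" and x0: "cadjoint J x = 0"
      then obtain v where x: "x = ?P (J v)" using rP rP_span by blast
      \<comment> \<open>One factor \<open>?P\<close> moves across and is absorbed by idempotence;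
        the remaining \<open>J\<close> moves across as \<open>cadjoint J\<close>, which kills
        \<open>x\<close>.\<close>
      have "cinner x x = cinner (J v) x"
        unfolding x by (simp add: wandering_projection_self_adjoint[OF S] wandering_projection_idem[OF S])
      also have "\<dots> = 0"
        using x0 by (simp flip: cinner_cadjoint_right[OF Jb])
      finally show "x = 0" by simp
    qed
  qed (rule complex_vector.subspace_span)
  then have "cdim (range ?D) = cdim (range ?P)"
    unfolding rD rP_span using B(1) J'.linear_axioms
    by (intro cdim_injective_image) auto
  moreover have "pure_rank \<SS> = rank_op ?P"
    by (simp add: assms(5) pure_rank_def free_semigroup_algebra_def wandering_projection_def[abs_def])
  \<comment> \<open>At the identity, \<open>cp_map\<close> unfolds to the sum in \<open>?D\<close>,
    so the second equality holds by definition.\<close>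
  ultimately show ?thesis
    by (simp add: rank_op_def cp_map_def)
qed

end
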